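(* Let $S\neq\mathbb Z_{\ge 0}$ be a numerical semigroup, let $m\in S$ be nonzero, and let $c_1<\dots<c_n$ be the elements of $\mathbb Z_{\ge 0}\setminus S$. Let $f$ be an arbitrary function on $\mathbb Z_{\ge 0}$ with values in a field $K$, let $z$ be an indeterminate, and let $p$ be an integer with $0<p\le m$. Then in the field $K(z)$ of rational functions $$\sum_{i=1}^n\frac{f(c_i+m)-f(c_i)}{(z-f(c_i))(z-f(c_i+m))}\Bigl(\sum_{J\subset T_i,\ |J|=p-1}\ \prod_{a\in J}(z-f(a))^{-1}\Bigr)=\sum_{I\subset S^{(m)},\ |I|=p}\ \prod_{a\in I}(z-f(a))^{-1}-\sum_{I\subset I_m,\ |I|=p}\ \prod_{a\in I}(z-f(a))^{-1}.$$ In particular, for $p=m$, $$\sum_{i=1}^n\frac{f(c_i+m)-f(c_i)}{(z-f(c_i))(z-f(c_i+m))}\prod_{a\in T_i}(z-f(a))^{-1}=\prod_{a\in S^{(m)}}(z-f(a))^{-1}-\prod_{a\in I_m}(z-f(a))^{-1}.$$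
   Context: A numerical semigroup is a set $S\subset\mathbb Z_{\ge 0}$ that contains $0$, is closed under addition and has finite complement in $\mathbb Z_{\ge 0}$. For a numerical semigroup $S$ and a nonzero $m\in S$, the Apéry set is $S^{(m)}:=\{s\in S: s-m\notin S\}$; it has exactly $m$ elements, one in each residue class mod $m$, and contains $0$. Put $I_m:=\{0,1,\dots,m-1\}$. With $\mathbb Z_{\ge 0}\setminus S=\{c_1<\dots<c_n\}$, let $S_0:=\mathbb Z_{\ge 0}$ and $S_i:=\mathbb Z_{\ge 0}\setminus\{c_1,\dots,c_i\}$ for $i=1,\dots,n$ (so $S_n=S$); each $S_i$ is a numerical semigroup containing $m$. For $i=1,\dots,n$ put $T_i:=S_i^{(m)}\setminus\{c_i+m\}=S_{i-1}^{(m)}\setminus\{c_i\}$, a set of $m-1$ elements. Empty products equal $1$. *)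

theory Defs
  imports "HOL-Computational_Algebra.Computational_Algebra"
begin

definition numerical_semigroup :: "nat set \<Rightarrow> bool" where
  "numerical_semigroup S \<longleftrightarrow>
     0 \<in> S \<and> (\<forall>a\<in>S. \<forall>b\<in>S. a + b \<in> S) \<and> finite (UNIV - S)"

text \<open>The guard \<open>m \<le> s\<close> is needed because the difference \<open>s - m\<close> is meant in the integers.\<close>

definition apery_set :: "nat set \<Rightarrow> nat \<Rightarrow> nat set" where
  "apery_set S m = {s \<in> S. \<not> (m \<le> s \<and> s - m \<in> S)}"

text \<open>
  The gaps \<open>c\<^sub>1 < \<dots> < c\<^sub>n\<close> are given by a function \<open>c\<close>, of which only the values on \<open>{1..n}\<close> matter.
\<close>

definition gap_enumeration :: "nat set \<Rightarrow> nat \<Rightarrow> (nat \<Rightarrow> nat) \<Rightarrow> bool" where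
  "gap_enumeration S n c \<longleftrightarrow> strict_mono_on {1..n} c \<and> c ` {1..n} = UNIV - S"

definition semigroup_chain :: "(nat \<Rightarrow> nat) \<Rightarrow> nat \<Rightarrow> nat set" where
  "semigroup_chain c i = UNIV - c ` {1..i}"

definition apery_common :: "(nat \<Rightarrow> nat) \<Rightarrow> nat \<Rightarrow> nat \<Rightarrow> nat set" where
  "apery_common c m i = apery_set (semigroup_chain c i) m - {c i + m}"

lemma apery_common_alt:
  assumes "gap_enumeration S n c" "i \<in> {1..n}"
  shows "apery_common c m i = apery_set (semigroup_chain c (i - 1)) m - {c i}"
proof -
  have "{1..i} = insert i {1..i - 1}" using assms(2) by auto
  define C where "C = c ` {1..i - 1}"
  have split: "c ` {1..i} = insert (c i) C"
    unfolding C_def \<open>{1..i} = insert i {1..i - 1}\<close> by simp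
  have "c k < c i" if "k \<in> {1..i - 1}" for k
  proof -
    have "k \<in> {1..n}" "k < i" using that assms(2) by auto
    then show ?thesis
      using assms unfolding gap_enumeration_def strict_mono_on_def by blast
  qed
  then have "c i \<notin> C" unfolding C_def by fastforce
  then show ?thesis
    unfolding apery_common_def apery_set_def semigroup_chain_def split C_def[symmetric]
    by auto
qed

text \<open>The field \<open>K(z)\<close> is the fraction field \<open>'k poly fract\<close> of \<open>K[z]\<close>.\<close>

definition ratfun_const :: "'k::field \<Rightarrow> 'k poly fract" where
  "ratfun_const a = to_fract [:a:]"

definition ratfun_var :: "'k::field poly fract" where
  "ratfun_var = to_fract [:0, 1:]"

end

theory Submission
  imports Defs
begin

text \<open>
  Passing from \<open>S\<^sub>i\<^sub>-\<^sub>1\<close> to \<open>S\<^sub>i\<close> exchanges the single element \<open>c\<^sub>i\<close> of the Apery set for \<open>c\<^sub>i + m\<close>, and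
  elementary symmetric polynomials are affine in each variable. Hence the \<open>i\<close>-th summand is the
  difference of the \<open>p\<close>-th elementary symmetric polynomials of \<open>1 / (z - f(a))\<close> over two consecutive
  Apery sets, and the sum telescopes from \<open>S\<^sub>0\<close>, whose Apery set is \<open>{0..<m}\<close>, to \<open>S\<^sub>n = S\<close>.
\<close>

text \<open>The elementary symmetric polynomial is evaluated at the family \<open>g\<close>, but
  subsets are taken of the index set \<open>A\<close>, so that repeated values of \<open>g\<close>
  count separately.\<close>

definition elem_sym :: "('a \<Rightarrow> 'b::comm_ring_1) \<Rightarrow> nat \<Rightarrow> 'a set \<Rightarrow> 'b" where
  "elem_sym g p A = (\<Sum>I | I \<subseteq> A \<and> card I = p. \<Prod>a\<in>I. g a)"

lemma elem_sym_card:
  assumes "finite A" "card A = p"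
  shows "elem_sym g p A = prod g A"
proof -
  have "{I. I \<subseteq> A \<and> card I = p} = {A}"
    using assms card_subset_eq[OF assms(1)] by auto
  then show ?thesis by (simp add: elem_sym_def)
qed

text \<open>Sort the \<open>p\<close>-subsets by whether they contain \<open>a\<close>; adjoining
  \<open>a\<close> is a bijection from the \<open>(p - 1)\<close>-subsets of \<open>A\<close> onto
  those that do. For \<open>p = 0\<close> the truncated \<open>p - 1\<close> would leave a spurious
  term \<open>g a\<close>.\<close>

lemma elem_sym_insert:
  assumes "finite A" "a \<notin> A" "0 < p"
  shows "elem_sym g p (insert a A) = elem_sym g p A + g a * elem_sym g (p - 1) A"
proof -
  let ?X = "{I. I \<subseteq> A \<and> card I = p}" and ?Y = "{I. I \<subseteq> A \<and> card I = p - 1}"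
  have fin: "finite I" if "I \<subseteq> A" for I
    using assms(1) that by (rule rev_finite_subset)
  have split: "{I. I \<subseteq> insert a A \<and> card I = p} = ?X \<union> insert a ` ?Y"
  proof (intro equalityI subsetI)
    fix I assume I: "I \<in> {I. I \<subseteq> insert a A \<and> card I = p}"
    show "I \<in> ?X \<union> insert a ` ?Y"
    proof (cases "a \<in> I")
      case True
      then have "I = insert a (I - {a})" "I - {a} \<in> ?Y" using I by auto
      then show ?thesis by blast
    next
      case False
      then show ?thesis using I by auto
    qed
  next
    fix I assume "I \<in> ?X \<union> insert a ` ?Y"
    then show "I \<in> {I. I \<subseteq> insert a A \<and> card I = p}"
    proof
      assume "I \<in> insert a ` ?Y"
      then obtain J where J: "J \<subseteq> A" "card J = p - 1" "I = insert a J" by blast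
      then have "finite J" "a \<notin> J" using fin assms(2) by auto
      then show ?thesis using J assms(3) by auto
    qed auto
  qed
  have inj: "inj_on (insert a) ?Y"
    using assms(2) by (intro inj_onI) (metis (lifting) insert_ident mem_Collect_eq subsetD)
  have "elem_sym g p (insert a A) = sum (prod g) ?X + sum (prod g) (insert a ` ?Y)"
    unfolding elem_sym_def split using assms(1,2) by (intro sum.union_disjoint) auto
  also have "sum (prod g) (insert a ` ?Y) = (\<Sum>J\<in>?Y. prod g (insert a J))"
    by (simp only: sum.reindex[OF inj] o_def)
  also have "\<dots> = (\<Sum>J\<in>?Y. g a * prod g J)"
    using assms(2) fin by (intro sum.cong refl prod.insert) auto
  finally show ?thesis by (simp add: elem_sym_def sum_distrib_left)
qed

text \<open>A polynomial of degree one is not constant, and \<open>to_fract\<close> is injective.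
  This makes all the denominators of the theorem nonzero.\<close>

lemma ratfun_var_neq_const: "ratfun_var \<noteq> ratfun_const a"
  by (simp add: ratfun_var_def ratfun_const_def)

lemma apery_set_chain_0: "apery_set (semigroup_chain c 0) m = {0..<m}"
  by (auto simp: apery_set_def semigroup_chain_def)

lemma semigroup_chain_last:
  assumes "gap_enumeration S n c"
  shows "semigroup_chain c n = S"
  using assms by (auto simp: gap_enumeration_def semigroup_chain_def)

lemma gap_enumeration_less:
  assumes "gap_enumeration S n c" "i \<in> {1..n}" "j \<in> {1..n}" "i < j"
  shows "c i < c j"
  using assms by (auto simp: gap_enumeration_def strict_mono_on_def)

text \<open>Since \<open>m\<close> lies in \<open>S\<close>, subtracting \<open>m\<close> from a gap
  can only give another gap. That gap is smaller than \<open>c i\<close>, so it has already been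
  removed at stage \<open>i - 1\<close>.\<close>

lemma gap_in_apery_set:
  assumes "numerical_semigroup S" "m \<in> S" "m \<noteq> 0" "gap_enumeration S n c" "i \<in> {1..n}"
  shows "c i \<in> apery_set (semigroup_chain c (i - 1)) m"
proof -
  have "c i \<noteq> c k" if "k \<in> {1..i - 1}" for k
    using gap_enumeration_less[OF assms(4), of k i] assms(5) that by fastforce
  then have "c i \<in> semigroup_chain c (i - 1)"
    by (fastforce simp: semigroup_chain_def)
  moreover have "c i - m \<notin> semigroup_chain c (i - 1)" if "m \<le> c i"
  proof -
    have "c i \<notin> S" using assms(4,5) by (auto simp: gap_enumeration_def)
    moreover have "c i - m + m = c i" using that by simp
    ultimately have "c i - m \<notin> S"
      using assms(1,2) unfolding numerical_semigroup_def by metis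
    then obtain k where k: "k \<in> {1..n}" "c k = c i - m"
      using assms(4) by (force simp: gap_enumeration_def)
    then have "c k < c i" using that assms(3) by simp
    then have "k < i"
      using gap_enumeration_less[OF assms(4), of i k] assms(5) k(1)
      by (metis less_asym less_irrefl linorder_neqE_nat)
    then have "k \<in> {1..i - 1}" using k(1) by auto
    then show ?thesis by (auto simp: semigroup_chain_def k(2)[symmetric])
  qed
  ultimately show ?thesis by (auto simp: apery_set_def)
qed

text \<open>Every number removed up to stage \<open>i\<close> is at most \<open>c i\<close>, so
  \<open>c i + m\<close> survives, whereas \<open>c i\<close> itself has just been removed.\<close>

lemma gap_plus_in_apery_set:
  assumes "gap_enumeration S n c" "i \<in> {1..n}" "m \<noteq> 0"
  shows "c i + m \<in> apery_set (semigroup_chain c i) m"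
proof -
  have "c k < c i + m" if "k \<in> {1..i}" for k
    using gap_enumeration_less[OF assms(1), of k i] assms(2,3) that
    by (cases "k = i") (auto intro: less_trans)
  then have "c i + m \<in> semigroup_chain c i"
    by (fastforce simp: semigroup_chain_def)
  moreover have "c i \<notin> semigroup_chain c i"
    using assms(2) by (auto simp: semigroup_chain_def)
  ultimately show ?thesis by (simp add: apery_set_def)
qed

text \<open>The initial set \<open>{0..<m}\<close> has \<open>m\<close> elements, and each stage
  trades one element for another.\<close>

lemma apery_set_chain_card:
  assumes "numerical_semigroup S" "m \<in> S" "m \<noteq> 0" "gap_enumeration S n c" "i \<le> n"
  shows "finite (apery_set (semigroup_chain c i) m) \<and> card (apery_set (semigroup_chain c i) m) = m"
  using assms(5)
proof (induction i)
  case 0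
  then show ?case by (simp add: apery_set_chain_0)
next
  case (Suc i)
  then have i: "Suc i \<in> {1..n}" by simp
  let ?A = "apery_set (semigroup_chain c i) m"
  let ?B = "apery_set (semigroup_chain c (Suc i)) m"
  have eq: "?B - {c (Suc i) + m} = ?A - {c (Suc i)}"
    using apery_common_alt[OF assms(4) i] by (simp add: apery_common_def)
  have a: "c (Suc i) \<in> ?A" using gap_in_apery_set[OF assms(1-4) i] by simp
  have b: "c (Suc i) + m \<in> ?B" by (rule gap_plus_in_apery_set[OF assms(4) i assms(3)])
  have A: "finite ?A" "card ?A = m" using Suc by auto
  have "finite (?B - {c (Suc i) + m})" unfolding eq using A(1) by simp
  then have "finite ?B" by simp
  moreover have "card ?B = m"
    using card.remove[OF \<open>finite ?B\<close> b] card.remove[OF A(1) a] A(2) eq by simp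
  ultimately show ?case by blast
qed

lemma apery_common_card:
  assumes "numerical_semigroup S" "m \<in> S" "m \<noteq> 0" "gap_enumeration S n c" "i \<in> {1..n}"
  shows "finite (apery_common c m i)" "card (apery_common c m i) = m - 1"
  using apery_set_chain_card[OF assms(1-4), of i] gap_plus_in_apery_set[OF assms(4,5,3)] assms(5)
  by (auto simp: apery_common_def)

text \<open>Both Apery sets arise from \<open>apery_common c m i\<close> by inserting one element.
  Expanding both by \<open>elem_sym_insert\<close>, the terms free of the inserted element
  cancel.\<close>

lemma elem_sym_apery_set_step:
  assumes "numerical_semigroup S" "m \<in> S" "m \<noteq> 0" "gap_enumeration S n c" "i \<in> {1..n}" "0 < p"
  shows "elem_sym g p (apery_set (semigroup_chain c i) m)
           - elem_sym g p (apery_set (semigroup_chain c (i - 1)) m)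
         = (g (c i + m) - g (c i)) * elem_sym g (p - 1) (apery_common c m i)"
proof -
  let ?T = "apery_common c m i"
  have "apery_set (semigroup_chain c i) m = insert (c i + m) ?T"
    using gap_plus_in_apery_set[OF assms(4,5,3)] by (auto simp: apery_common_def)
  moreover have "apery_set (semigroup_chain c (i - 1)) m = insert (c i) ?T"
    using gap_in_apery_set[OF assms(1-5)] by (auto simp: apery_common_alt[OF assms(4,5)])
  moreover have "c i + m \<notin> ?T" by (simp add: apery_common_def)
  moreover have "c i \<notin> ?T" by (simp add: apery_common_alt[OF assms(4,5)])
  ultimately show ?thesis
    using apery_common_card(1)[OF assms(1-5)] assms(6)
    by (simp add: elem_sym_insert algebra_simps)
qed

text \<open>This is the theorem for arbitrary weights \<open>g\<close> in a commutative ring;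
  rational functions enter only when \<open>g\<close> is specialised.\<close>

lemma elem_sym_apery_set_telescope:
  assumes "numerical_semigroup S" "m \<in> S" "m \<noteq> 0" "gap_enumeration S n c" "0 < p"
  shows "(\<Sum>i = 1..n. (g (c i + m) - g (c i)) * elem_sym g (p - 1) (apery_common c m i))
         = elem_sym g p (apery_set S m) - elem_sym g p {0..<m}"
proof -
  let ?E = "\<lambda>i. elem_sym g p (apery_set (semigroup_chain c i) m)"
  have "(\<Sum>i = 1..n. (g (c i + m) - g (c i)) * elem_sym g (p - 1) (apery_common c m i))
        = (\<Sum>i = Suc 0..n. ?E i - ?E (i - 1))"
    by (intro sum.cong elem_sym_apery_set_step[OF assms(1-4) _ assms(5), symmetric]) auto
  also have "\<dots> = ?E n - ?E 0" by (rule sum_telescope''[OF le0])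
  finally show ?thesis
    using semigroup_chain_last[OF assms(4)] by (simp add: apery_set_chain_0)
qed

theorem mainTheorem2:
  fixes S :: "nat set" and m n :: nat and c :: "nat \<Rightarrow> nat"
    and f :: "nat \<Rightarrow> 'k::field"
  defines "z \<equiv> (ratfun_var :: 'k poly fract)"
    and "F \<equiv> (\<lambda>a. ratfun_const (f a))"
  assumes "numerical_semigroup S"
    and "S \<noteq> UNIV"
    and "m \<in> S" and "m \<noteq> 0"
    and "gap_enumeration S n c"
  shows "(\<forall>p::nat. 0 < p \<and> p \<le> m \<longrightarrow>
       (\<Sum>i = 1..n. (F (c i + m) - F (c i)) / ((z - F (c i)) * (z - F (c i + m))) *
          (\<Sum>J | J \<subseteq> apery_common c m i \<and> card J = p - 1. \<Prod>a\<in>J. inverse (z - F a)))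
       = (\<Sum>I | I \<subseteq> apery_set S m \<and> card I = p. \<Prod>a\<in>I. inverse (z - F a))
         - (\<Sum>I | I \<subseteq> {0..<m} \<and> card I = p. \<Prod>a\<in>I. inverse (z - F a)))
    \<and> (\<Sum>i = 1..n. (F (c i + m) - F (c i)) / ((z - F (c i)) * (z - F (c i + m))) *
          (\<Prod>a\<in>apery_common c m i. inverse (z - F a)))
       = (\<Prod>a\<in>apery_set S m. inverse (z - F a)) - (\<Prod>a\<in>{0..<m}. inverse (z - F a))"
proof -
  note hyps = \<open>numerical_semigroup S\<close> \<open>m \<in> S\<close> \<open>m \<noteq> 0\<close> \<open>gap_enumeration S n c\<close>
  define g where "g = (\<lambda>a. inverse (z - F a))"
  have nz: "z - F a \<noteq> 0" for a
    using ratfun_var_neq_const[of "f a"] by (simp add: z_def F_def)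
  \<comment> \<open>Partial fractions: the coefficient of each summand is a difference of two
    reciprocals, as the telescoping identity requires.\<close>
  have coeff: "(F b - F a) / ((z - F a) * (z - F b)) = g b - g a" for a b
    using nz[of a] nz[of b] by (simp add: g_def field_simps)
  have main: "(\<Sum>i = 1..n. (g (c i + m) - g (c i)) * elem_sym g (p - 1) (apery_common c m i))
      = elem_sym g p (apery_set S m) - elem_sym g p {0..<m}" if "0 < p" for p
    using hyps that by (rule elem_sym_apery_set_telescope)
  \<comment> \<open>For \<open>p = m\<close> each of the three elementary symmetric polynomials has
    top degree, since \<open>apery_common c m i\<close> has \<open>m - 1\<close> elements and the
    other two sets have \<open>m\<close>; each is thus a single product.\<close>
  have "(\<Sum>i = 1..n. (g (c i + m) - g (c i)) * prod g (apery_common c m i))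
      = (\<Sum>i = 1..n. (g (c i + m) - g (c i)) * elem_sym g (m - 1) (apery_common c m i))"
    using apery_common_card[OF hyps] by (intro sum.cong) (simp_all add: elem_sym_card)
  also have "\<dots> = elem_sym g m (apery_set S m) - elem_sym g m {0..<m}"
    using main \<open>m \<noteq> 0\<close> by simp
  also have "\<dots> = prod g (apery_set S m) - prod g {0..<m}"
    using apery_set_chain_card[OF hyps order_refl] semigroup_chain_last[OF hyps(4)]
    by (simp add: elem_sym_card)
  finally show ?thesis
    using main unfolding coeff elem_sym_def g_def by blast
qed

end
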